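(* Let $\mathbb{K}$ be $\mathbb{R}$ or $\mathbb{C}$. The set $\mathrm{IMPS}(2,4,q)\subset(\mathbb{K}^4)^{\otimes q}$ is not closed whenever $q>1$ is odd.
   Context: Closedness is with respect to the Euclidean topology on finite-dimensional $\mathbb{K}$-vector spaces. For a tensor $T\in(\mathbb{K}^k)^{\otimes q}$ write $T[i_1,\dots,i_q]$ for its coordinates in the standard basis. For integers $r>0$, $k>0$, $q>1$, the set $\mathrm{IMPS}(r,k,q)\subset(\mathbb{K}^k)^{\otimes q}$ of site-independent (cyclic) matrix product states consists of all tensors $T$ for which there exist matrices $M_1,\dots,M_k\in\mathbb{K}^{r\times r}$ such that $T[i_1,\dots,i_q]=\operatorname{tr}(M_{i_1}M_{i_2}\cdots M_{i_q})$ for all $1\le i_1,\dots,i_q\le k$. *)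

theory Defs
  imports "HOL-Analysis.Analysis" "Jordan_Normal_Form.Matrix"
begin

definition multi_indices :: "nat \<Rightarrow> nat \<Rightarrow> nat list set" where
  "multi_indices k q = {is. length is = q \<and> set is \<subseteq> {1..k}}"

text \<open>
  A tensor of order \<open>q\<close> over \<open>K\<^sup>k\<close> is its array of coordinates in the standard basis: the list
  \<open>[i\<^sub>1, \<dots>, i\<^sub>q]\<close> is sent to \<open>T[i\<^sub>1, \<dots>, i\<^sub>q]\<close>. The topology is the product of \<open>k ^ q\<close> copies of the
  scalar field, which is the Euclidean topology of this finite-dimensional space.
  Its carrier consists of functions that are \<open>undefined\<close> outside \<open>multi_indices k q\<close>.
\<close>

definition tensors :: "nat \<Rightarrow> nat \<Rightarrow> (nat list \<Rightarrow> 'a) set" where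
  "tensors k q = (multi_indices k q \<rightarrow>\<^sub>E UNIV)"

definition tensor_topology :: "nat \<Rightarrow> nat \<Rightarrow> (nat list \<Rightarrow> 'a::topological_space) topology" where
  "tensor_topology k q = product_topology (\<lambda>_. euclidean) (multi_indices k q)"

lemma topspace_tensor_topology: "topspace (tensor_topology k q) = tensors k q"
  by (simp add: tensor_topology_def tensors_def)

definition mat_trace :: "'a::comm_monoid_add mat \<Rightarrow> 'a" where
  "mat_trace A = (\<Sum>i<dim_row A. A $$ (i, i))"

definition mat_prod_list :: "nat \<Rightarrow> 'a::semiring_1 mat list \<Rightarrow> 'a mat" where
  "mat_prod_list r As = foldr (*) As (1\<^sub>m r)"

definition IMPS :: "nat \<Rightarrow> nat \<Rightarrow> nat \<Rightarrow> (nat list \<Rightarrow> 'a::field) set" where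
  "IMPS r k q = {T \<in> tensors k q. \<exists>M :: nat \<Rightarrow> 'a mat.
     (\<forall>i\<in>{1..k}. M i \<in> carrier_mat r r) \<and>
     (\<forall>is\<in>multi_indices k q. T is = mat_trace (mat_prod_list r (map M is)))}"

end

(*
  Let A = diag(1,-1), B = E11, C = E12, D = E21, with weights 0, 2, 1, 1. For odd q the trace of a
  product of q of these matrices vanishes if the total weight is less than 2: a product of weight 1
  is off-diagonal, and tr(A^q) = 0. Hence, after multiplying a matrix of weight w by x^2 / x^(q w),
  the traces converge as x tends to infinity, and the limit T keeps exactly the coordinates of
  weight 2.

  Suppose T is given by matrices A, B, C, D. Its coordinates show that these form a basis of the
  2x2 matrices, so that a matrix X is determined by the traces of XA, XB, XC, XD. This yields
  N := A^(q-2) B = A^(q-3) B A = B A^(q-2) and A^(q-3) B^2 = 0. Thus N commutes with A and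
  N^2 = 0, so NA is nilpotent although its trace is the coordinate 1 of T.
*)

theory Submission
  imports Defs "Jordan_Normal_Form.Determinant"
begin

section \<open>Two-by-two matrices and the trace form\<close>

definition mat2 :: "'a \<Rightarrow> 'a \<Rightarrow> 'a \<Rightarrow> 'a \<Rightarrow> 'a mat" where
  "mat2 a b c d =
     mat 2 2 (\<lambda>(i, j). if i = 0 then (if j = 0 then a else b) else (if j = 0 then c else d))"

lemma mat2_carrier [simp]: "mat2 a b c d \<in> carrier_mat 2 2"
  by (simp add: mat2_def)

lemma less_2_iff: "i < 2 \<longleftrightarrow> i = 0 \<or> i = (1::nat)"
  by auto

lemma mat2_times [simp]:
  fixes a :: "'a::semiring_0"
  shows "mat2 a b c d * mat2 a' b' c' d' =
    mat2 (a * a' + b * c') (a * b' + b * d') (c * a' + d * c') (c * b' + d * d')"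
  by (rule eq_matI)
    (auto simp: mat2_def scalar_prod_def less_2_iff numeral_2_eq_2)

lemma mat2_one: "1\<^sub>m 2 = mat2 1 0 0 (1::'a::semiring_1)"
  by (rule eq_matI) (auto simp: mat2_def)

lemma mat2_zero: "0\<^sub>m 2 2 = mat2 0 0 0 (0::'a::zero)"
  by (rule eq_matI) (auto simp: mat2_def)

lemma mat2_inject [simp]:
  "mat2 a b c d = mat2 a' b' c' d' \<longleftrightarrow> a = a' \<and> b = b' \<and> c = c' \<and> d = d'"
proof
  assume eq: "mat2 a b c d = mat2 a' b' c' d'"
  have "mat2 a b c d $$ (i, j) = mat2 a' b' c' d' $$ (i, j)" for i j
    by (simp add: eq)
  from this[of 0 0] this[of 0 1] this[of 1 0] this[of 1 1]
  show "a = a' \<and> b = b' \<and> c = c' \<and> d = d'"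
    by (simp add: mat2_def)
qed simp

lemma mat_trace_mat2 [simp]: "mat_trace (mat2 a b c d) = a + (d::'a::comm_monoid_add)"
  by (simp add: mat_trace_def mat2_def numeral_2_eq_2)

lemma mat2_cases:
  assumes "A \<in> carrier_mat 2 2"
  obtains a b c d where "A = mat2 a b c d"
proof
  show "A = mat2 (A $$ (0, 0)) (A $$ (0, 1)) (A $$ (1, 0)) (A $$ (1, 1))"
    using assms by (intro eq_matI) (auto simp: mat2_def less_2_iff)
qed

text \<open>The upper right entry of the square is b (a + d). Either the trace vanishes at once, or
  b = 0 and the diagonal of the square leaves a a = d d = 0. No eigenvalues are needed.\<close>

lemma mat_trace_eq_0_if_square_eq_0:
  fixes A :: "'a::idom mat"
  assumes A: "A \<in> carrier_mat 2 2" and sq: "A * A = 0\<^sub>m 2 2"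
  shows "mat_trace A = 0"
proof -
  obtain a b c d where [simp]: "A = mat2 a b c d"
    using A by (rule mat2_cases)
  have eqs: "a * a + b * c = 0" "a * b + b * d = 0" "c * b + d * d = 0"
    using sq by (simp_all add: mat2_zero)
  have "b * (a + d) = 0"
    using eqs(2) by (simp add: algebra_simps)
  then have "b = 0 \<or> a + d = 0"
    by simp
  then show ?thesis
    using eqs by auto
qed

lemma mat_trace_smult: "mat_trace (k \<cdot>\<^sub>m A) = k * mat_trace (A::'a::comm_semiring_1 mat)"
  if "A \<in> carrier_mat n n"
  using that by (simp add: mat_trace_def sum_distrib_left)

text \<open>Reading \<open>U\<close> by rows and \<open>X\<close> by columns turns the trace pairing
  into a product of vectors of length 4.\<close>

lemma mat_trace_mult_2:
  fixes U X :: "'a::semiring_0 mat"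
  assumes "U \<in> carrier_mat 2 2" "X \<in> carrier_mat 2 2"
  shows "mat_trace (U * X) = (\<Sum>k = 0..<4. U $$ (k div 2, k mod 2) * X $$ (k mod 2, k div 2))"
proof -
  have "{0..<4} = {0, 1, 2, 3::nat}"
    by auto
  moreover have "{..<2} = {0, 1::nat}" "{0..<2} = {0, 1::nat}"
    by auto
  ultimately show ?thesis
    using assms by (simp add: mat_trace_def scalar_prod_def add.assoc)
qed

text \<open>After flattening, \<open>dual\<close> says that the 4x4 matrix \<open>G\<close> with
  columns \<open>X j\<close> has the left inverse \<open>H\<close>. So \<open>G\<close> is
  invertible, and the row vector \<open>flat U\<close> can be recovered from
  \<open>flat U * G\<close>, whose entries are the given traces.\<close>

lemma eq_if_mat_trace_eq:
  fixes U V :: "'a::field mat" and X Y :: "nat \<Rightarrow> 'a mat"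
  assumes X: "\<And>j. j < 4 \<Longrightarrow> X j \<in> carrier_mat 2 2"
    and Y: "\<And>i. i < 4 \<Longrightarrow> Y i \<in> carrier_mat 2 2"
    and dual: "\<And>i j. i < 4 \<Longrightarrow> j < 4 \<Longrightarrow> mat_trace (Y i * X j) = (if i = j then 1 else 0)"
    and U: "U \<in> carrier_mat 2 2" and V: "V \<in> carrier_mat 2 2"
    and eq: "\<And>j. j < 4 \<Longrightarrow> mat_trace (U * X j) = mat_trace (V * X j)"
  shows "U = V"
proof -
  define G where "G = mat 4 4 (\<lambda>(k, j). X j $$ (k mod 2, k div 2))"
  define H where "H = mat 4 4 (\<lambda>(i, k). Y i $$ (k div 2, k mod 2))"
  define flat where "flat W = mat 1 4 (\<lambda>(_, k). W $$ (k div 2, k mod 2))" for W :: "'a mat"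
  have carr: "G \<in> carrier_mat 4 4" "H \<in> carrier_mat 4 4" "flat W \<in> carrier_mat 1 4" for W
    by (simp_all add: G_def H_def flat_def)
  have "H * G = 1\<^sub>m 4"
  proof (rule eq_matI)
    fix i j :: nat assume "i < dim_row (1\<^sub>m 4)" "j < dim_col (1\<^sub>m 4)"
    then show "(H * G) $$ (i, j) = 1\<^sub>m 4 $$ (i, j)"
      using dual[of i j] mat_trace_mult_2[OF Y[of i] X[of j]]
      by (simp add: G_def H_def scalar_prod_def)
  qed (simp_all add: G_def H_def)
  then have GH: "G * H = 1\<^sub>m 4"
    using carr mat_mult_left_right_inverse by blast
  have flat: "(flat W * G) $$ (0, j) = mat_trace (W * X j)"
    if "j < 4" "W \<in> carrier_mat 2 2" for W j
    using that mat_trace_mult_2[OF that(2) X[of j]]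
    by (simp add: G_def flat_def scalar_prod_def)
  have "flat U * G = flat V * G"
    by (rule eq_matI) (use flat U V eq carr in \<open>auto simp: G_def flat_def\<close>)
  then have "flat U * (G * H) = flat V * (G * H)"
    using carr by (metis assoc_mult_mat)
  then have UV: "flat U = flat V"
    using GH right_mult_one_mat[OF carr(3)] by simp
  show ?thesis
  proof (rule eq_matI)
    fix i j assume "i < dim_row V" "j < dim_col V"
    then have ij: "i < 2" "j < 2"
      using V by auto
    have "W $$ (i, j) = flat W $$ (0, 2 * i + j)" for W
      using ij by (simp add: flat_def)
    then show "U $$ (i, j) = V $$ (i, j)"
      by (simp add: UV)
  qed (use U V in auto)
qed

section \<open>Matrix products along words\<close>

lemma mat_prod_list_carrier:
  "set As \<subseteq> carrier_mat n n \<Longrightarrow> mat_prod_list n As \<in> carrier_mat n n"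
  by (induction As) (auto simp: mat_prod_list_def)

lemma mat_prod_list_Nil [simp]: "mat_prod_list n [] = 1\<^sub>m n"
  and mat_prod_list_Cons [simp]: "mat_prod_list n (A # As) = A * mat_prod_list n As"
  by (simp_all add: mat_prod_list_def)

lemma mat_prod_list_append:
  assumes "set As \<subseteq> carrier_mat n n" "set Bs \<subseteq> carrier_mat n n"
  shows "mat_prod_list n (As @ Bs) = mat_prod_list n As * mat_prod_list n Bs"
  using assms
proof (induction As)
  case Nil
  then show ?case
    using mat_prod_list_carrier[of Bs n] by simp
next
  case (Cons A As)
  then show ?case
    using mat_prod_list_carrier[of As n] mat_prod_list_carrier[of Bs n]
    by (simp add: assoc_mult_mat[of A n n _ n _ n])
qed

lemma mat_prod_list_smult:
  fixes A :: "'b \<Rightarrow> 'a::comm_ring_1 mat"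
  assumes "\<And>i. i \<in> set is \<Longrightarrow> A i \<in> carrier_mat n n"
  shows "mat_prod_list n (map (\<lambda>i. c i \<cdot>\<^sub>m A i) is) =
    prod_list (map c is) \<cdot>\<^sub>m mat_prod_list n (map A is)"
  using assms
proof (induction "is")
  case Nil
  then show ?case
    by (auto intro!: eq_matI)
next
  case (Cons i "is")
  have "mat_prod_list n (map A is) \<in> carrier_mat n n"
    using Cons.prems by (intro mat_prod_list_carrier) auto
  moreover have "A i \<in> carrier_mat n n"
    using Cons.prems by simp
  moreover have "b \<cdot>\<^sub>m (a \<cdot>\<^sub>m B) = (a * b) \<cdot>\<^sub>m B" for a b and B :: "'a mat"
    by (rule eq_matI) (simp_all add: mult_ac)
  ultimately show ?case
    using Cons by (simp add: mult_smult_distrib[of _ n n _ n] mult_smult_assoc_mat[of _ n n _ n])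
qed

section \<open>The base matrices, their weights and traces\<close>

definition base_mat :: "nat \<Rightarrow> 'a::comm_ring_1 mat" where
  "base_mat i = (if i = 1 then mat2 1 0 0 (-1) else if i = 2 then mat2 1 0 0 0
     else if i = 3 then mat2 0 1 0 0 else mat2 0 0 1 0)"

definition weight :: "nat list \<Rightarrow> nat" where
  "weight is = sum_list (map (\<lambda>i. if i = 1 then 0 else if i = 2 then 2 else 1) is)"

definition base_trace :: "nat list \<Rightarrow> 'a::comm_ring_1" where
  "base_trace is = mat_trace (mat_prod_list 2 (map base_mat is))"

definition limit_tensor :: "nat \<Rightarrow> nat list \<Rightarrow> 'a::comm_ring_1" where
  "limit_tensor q =
     restrict (\<lambda>is. if weight is = 2 then base_trace is else 0) (multi_indices 4 q)"

lemma base_mat_carrier [simp]: "base_mat i \<in> carrier_mat 2 2"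
  by (simp add: base_mat_def)

lemma weight_simps [simp]:
  "weight [] = 0"
  "weight (i # is) = (if i = 1 then 0 else if i = 2 then 2 else 1) + weight is"
  "weight (is @ js) = weight is + weight js"
  "weight (replicate m (Suc 0)) = 0"
  by (simp_all add: weight_def sum_list_replicate)

lemma weight_eq_0D: "weight is = 0 \<Longrightarrow> is = replicate (length is) (Suc 0)"
  by (induction "is") (auto split: if_splits)

lemma base_replicate:
  "mat_prod_list 2 (map base_mat (replicate m (Suc 0))) = mat2 1 0 0 ((-1) ^ m)"
  by (induction m) (simp_all add: base_mat_def mat2_one)

lemma base_replicate_append:
  "mat_prod_list 2 (map base_mat (replicate m (Suc 0) @ is)) =
   mat2 1 0 0 ((-1) ^ m) * mat_prod_list 2 (map base_mat is)"
  unfolding map_append by (subst mat_prod_list_append) (auto simp: base_replicate simp del: map_replicate)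

text \<open>Indices 1 and 2 have even weight and diagonal matrices, the others have weight 1 and
  antidiagonal matrices. Hence the parity of the weight counts the antidiagonal factors.\<close>

lemma base_prod_parity:
  "\<exists>a b. mat_prod_list 2 (map base_mat is) =
     (if even (weight is) then mat2 a 0 0 b else mat2 0 a b (0::'a::comm_ring_1))"
proof (induction "is")
  case Nil
  then show ?case
    by (auto simp: mat2_one)
next
  case (Cons i "is")
  then obtain a b :: 'a where ab: "mat_prod_list 2 (map base_mat is) =
      (if even (weight is) then mat2 a 0 0 b else mat2 0 a b 0)"
    by blast
  then show ?case
    unfolding list.map mat_prod_list_Cons base_mat_def[of i]
    by (cases "even (weight is)") auto
qed

text \<open>Weight 0 leaves only powers of A, with trace 1 + (-1)^q = 0 for odd length q; weight 1
  gives an antidiagonal product.\<close>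

lemma base_trace_eq_0:
  assumes "odd (length is)" "weight is < 2"
  shows "base_trace is = (0::'a::comm_ring_1)"
proof -
  consider "weight is = 0" | "odd (weight is)"
    using assms(2) by (auto simp: less_2_iff)
  then show ?thesis
  proof cases
    case 1
    then have "mat_prod_list 2 (map base_mat is) = mat2 1 0 0 ((-1) ^ length is :: 'a)"
      using base_replicate weight_eq_0D by metis
    then show ?thesis
      using assms(1) by (simp add: base_trace_def)
  next
    case 2
    then show ?thesis
      using base_prod_parity[of "is", where 'a = 'a] by (auto simp: base_trace_def)
  qed
qed

lemma prod_list_scaling:
  fixes c d :: "'a::comm_monoid_mult"
  shows "prod_list (map (\<lambda>i. c * d ^ weight [i]) is) = c ^ length is * d ^ weight is"
  by (induction "is") (simp_all add: power_add mult_ac)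

text \<open>With d = x^(-q), scaling an index of weight w by x^2 d^w multiplies the trace of a word
  of length q by x^(2q) d^weight, and x^(2q) = d^(-2).\<close>

lemma scaled_tensor_in_IMPS:
  fixes x :: "'a::field"
  assumes "odd q" and x: "x \<noteq> 0"
  shows "restrict (\<lambda>is. inverse (x ^ q) ^ (weight is - 2) * base_trace is) (multi_indices 4 q)
    \<in> IMPS 2 4 q"
proof -
  define d where "d = inverse (x ^ q)"
  define M where "M i = (x\<^sup>2 * d ^ weight [i]) \<cdot>\<^sub>m base_mat i" for i
  have carr: "M i \<in> carrier_mat 2 2" for i
    by (simp add: M_def)
  have "d ^ (weight is - 2) * base_trace is = mat_trace (mat_prod_list 2 (map M is))"
    if len: "length is = q" for "is"
  proof -
    have "mat_trace (mat_prod_list 2 (map M is)) = (x\<^sup>2) ^ q * d ^ weight is * base_trace is"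
      unfolding M_def
      by (subst mat_prod_list_smult)
        (auto simp: prod_list_scaling len base_trace_def simp del: weight_simps
          intro!: mat_trace_smult[where n = 2] mat_prod_list_carrier)
    also have "(x\<^sup>2) ^ q * d ^ 2 = 1"
      using x by (simp add: d_def flip: power_mult power_mult_distrib)
        (simp add: mult.commute power_inverse flip: power_mult)
    then have "(x\<^sup>2) ^ q * d ^ weight is * base_trace is = d ^ (weight is - 2) * base_trace is"
    \<comment> \<open>Below weight 2 the subtraction \<open>weight is - 2\<close> truncates to 0,
      which is harmless because the trace itself vanishes.\<close>
    proof (cases "weight is < 2")
      case True
      then show ?thesis
        using base_trace_eq_0[of "is", where 'a = 'a] assms(1) len by simp
    next
      case False
      then have "d ^ weight is = d ^ 2 * d ^ (weight is - 2)"
        by (metis le_add_diff_inverse not_less power_add)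
      then show ?thesis
        using \<open>(x\<^sup>2) ^ q * d ^ 2 = 1\<close> by (metis mult.assoc mult_1)
    qed
    finally show ?thesis ..
  qed
  then show ?thesis
    using carr unfolding IMPS_def d_def[symmetric]
    by (auto simp: tensors_def multi_indices_def intro!: exI[of _ M])
qed

text \<open>Convergence is coordinatewise: the factor tends to 0 above weight 2 and is constantly 1
  at weight 2, while below weight 2 the trace is 0.\<close>

lemma limit_tensor_limitin:
  fixes x :: "nat \<Rightarrow> 'a::real_normed_field"
  assumes "odd q" and x: "filterlim x at_infinity sequentially"
  shows "limitin (tensor_topology 4 q)
    (\<lambda>n. restrict (\<lambda>is. inverse (x n ^ q) ^ (weight is - 2) * base_trace is) (multi_indices 4 q))
    (limit_tensor q) sequentially"
proof -
  have "q > 0"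
    using assms(1) by (rule odd_pos)
  moreover have "(\<lambda>n. inverse (x n)) \<longlonglongrightarrow> 0"
    using filterlim_compose[OF tendsto_inverse_0 x] .
  ultimately have d: "(\<lambda>n. inverse (x n ^ q)) \<longlonglongrightarrow> 0"
    unfolding power_inverse[symmetric] by (rule tendsto_null_power[rotated])
  have "(\<lambda>n. inverse (x n ^ q) ^ (weight is - 2) * base_trace is) \<longlonglongrightarrow>
    (if weight is = 2 then base_trace is else 0)" if "length is = q" for "is"
  proof (cases "weight is > 2")
    case True
    then show ?thesis
      using tendsto_mult_left_zero[OF tendsto_null_power[OF d, of "weight is - 2"]] by simp
  next
    case False
    then show ?thesis
      using base_trace_eq_0[of "is", where 'a = 'a] that assms(1)
      by (cases "weight is = 2") auto
  qed
  then show ?thesis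
    unfolding tensor_topology_def limitin_componentwise
    by (auto simp: limit_tensor_def multi_indices_def)
qed

lemma limit_tensor_notin_IMPS:
  assumes "odd q" "q > 1"
  shows "limit_tensor q \<notin> (IMPS 2 4 q :: (nat list \<Rightarrow> 'a::field) set)"
proof
  assume "limit_tensor q \<in> (IMPS 2 4 q :: (nat list \<Rightarrow> 'a) set)"
  then obtain M :: "nat \<Rightarrow> 'a mat" where M: "\<forall>i\<in>{1..4}. M i \<in> carrier_mat 2 2"
    and T: "\<And>is. is \<in> multi_indices 4 q \<Longrightarrow>
      limit_tensor q is = mat_trace (mat_prod_list 2 (map M is))"
    unfolding IMPS_def by auto
  \<comment> \<open>Here q is at least 3, so nothing is truncated. Words of length m + 2 = q - 1
    become coordinates of the tensor after appending one index.\<close>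
  define m where "m = q - 3"
  have q: "q = m + 3" and "even m"
    using assms by (auto simp: m_def elim!: oddE)
  define P where "P is = mat_prod_list 2 (map M is)" for "is"
  have P_carrier [simp]: "P is \<in> carrier_mat 2 2" if "set is \<subseteq> {1..4}" for "is"
    unfolding P_def using M that by (intro mat_prod_list_carrier) auto
  have P_append: "P (is @ js) = P is * P js" if "set is \<subseteq> {1..4}" "set js \<subseteq> {1..4}" for "is" js
    unfolding P_def map_append using M that by (intro mat_prod_list_append) auto
  have tr: "mat_trace (P is) = (if weight is = 2 then base_trace is else 0)"
    if "set is \<subseteq> {1..4}" "length is = q" for "is"
    using T[of "is"] that by (simp add: P_def limit_tensor_def multi_indices_def)
  \<comment> \<open>The words Y 0, ..., Y 3 give the basis dual to M 1, ..., M 4 under the trace form.\<close>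
  define Y where "Y i = ([replicate (m + 1) (Suc 0) @ [2], replicate (m + 2) (Suc 0),
    replicate m (Suc 0) @ [4, 1], replicate (m + 1) (Suc 0) @ [3]] ! i)" for i
  have less_4_iff: "i < 4 \<longleftrightarrow> i = 0 \<or> i = 1 \<or> i = 2 \<or> i = (3::nat)" for i
    by auto
  have base: "base_trace (replicate l (Suc 0) @ is) =
    mat_trace (mat2 1 0 0 ((-1) ^ l) * mat_prod_list 2 (map base_mat is) :: 'a mat)" for l "is"
    by (simp only: base_trace_def base_replicate_append)
  have Y: "set (Y i) \<subseteq> {1..4}" "length (Y i) = m + 2" if "i < 4" for i
    using that by (auto simp: Y_def less_4_iff)
  \<comment> \<open>The words \<open>Y i\<close> have weights 2, 0, 1, 1. Off the diagonal, total
    weight 2 occurs only when 4 is appended to \<open>Y 2\<close> or 3 to \<open>Y 3\<close>, and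
    there the base product is 0. In \<open>Y 2\<close> the final 1 stands after 4, so that E22 meets
    the even power A^m and the trace is 1 rather than -1.\<close>
  have dual: "mat_trace (P (Y i @ [Suc j])) = (if i = j then 1 else 0)"
    if "i < 4" "j < 4" for i j
    using that tr[of "Y i @ [Suc j]"] Y[of i] \<open>even m\<close> unfolding less_4_iff
    by (elim disjE)
      (simp_all add: Y_def q base base_mat_def mat2_one del: replicate.simps replicate_Suc)
  \<comment> \<open>Matrix identities can now be read off from coordinates of the tensor.\<close>
  have P_eqI: "P u = V"
    if u: "set u \<subseteq> {1..4}" and V: "V \<in> carrier_mat 2 2"
      and eq: "\<And>j. j < 4 \<Longrightarrow> mat_trace (P (u @ [Suc j])) = mat_trace (V * P [Suc j])" for u V
  proof (rule eq_if_mat_trace_eq[where X = "\<lambda>j. P [Suc j]" and Y = "\<lambda>i. P (Y i)"])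
    show "mat_trace (P u * P [Suc j]) = mat_trace (V * P [Suc j])" if "j < 4" for j
      using that u eq[of j] by (simp add: P_append)
    show "mat_trace (P (Y i) * P [Suc j]) = (if i = j then 1 else 0)" if "i < 4" "j < 4" for i j
      using that dual[of i j] Y[of i] by (simp add: P_append)
  qed (use u V Y in auto)
  define a where "a = replicate (m + 1) (Suc 0)"
  \<comment> \<open>These words spell A^(q-2) B, A^(q-3) B A, B A^(q-2) and A^(q-3) B^2.\<close>
  define u1 where "u1 = a @ [2]"
  define u2 where "u2 = replicate m (Suc 0) @ [2, Suc 0]"
  define u3 where "u3 = 2 # a"
  define u4 where "u4 = replicate m (Suc 0) @ [2, 2]"
  note u_defs = u1_def u2_def u3_def u4_def a_def
  have sets [simp]: "set a \<subseteq> {Suc 0..4}" "set u1 \<subseteq> {Suc 0..4}" "set u2 \<subseteq> {Suc 0..4}"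
    "set u3 \<subseteq> {Suc 0..4}" "set u4 \<subseteq> {Suc 0..4}"
    "set (replicate m (Suc 0)) \<subseteq> {Suc 0..4}"
    by (auto simp: u_defs)
  have tr_u: "mat_trace (P (u @ [Suc j])) = (if j = 0 then 1 else 0)"
    if "u \<in> {u1, u2, u3}" "j < 4" for u j
  proof -
    \<comment> \<open>The word from \<open>u3\<close> starts with 2, whereas \<open>base\<close>
      only peels off leading ones, so its trace is computed directly.\<close>
    have "base_trace (2 # a @ [Suc 0]) = (1::'a)"
      using base_replicate[of "m + 2", where 'a = 'a]
      by (simp add: base_trace_def a_def base_mat_def replicate_append_same)
    then show ?thesis
      using sets(6) that tr[of "u @ [Suc j]"] \<open>even m\<close> unfolding less_4_iff
      by (elim insertE emptyE disjE)
        (simp_all add: u_defs q base base_mat_def mat2_one del: replicate.simps replicate_Suc)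
  qed
  have "P u1 = P u" if "u \<in> {u2, u3}" for u
    using that by (intro P_eqI; elim insertE emptyE; simp add: tr_u flip: P_append)
  then have 2: "P u1 = P u2" and 3: "P u1 = P u3"
    by simp_all
  \<comment> \<open>Every extension of \<open>u4\<close> has weight at least 4, where the limit
    tensor is 0.\<close>
  have 4: "P u4 = 0\<^sub>m 2 2"
  proof (rule P_eqI)
    fix j :: nat assume "j < 4"
    then have "mat_trace (P (u4 @ [Suc j])) = 0"
      using tr[of "u4 @ [Suc j]"] sets(5,6) by (auto simp: u4_def q)
    also have "0 = mat_trace (0\<^sub>m 2 2 * P [Suc j])"
      using \<open>j < 4\<close> by (subst left_mult_zero_mat[OF P_carrier]) (auto simp: mat_trace_def)
    finally show "mat_trace (P (u4 @ [Suc j])) = mat_trace (0\<^sub>m 2 2 * P [Suc j])" .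
  qed auto
  define A where "A = P [1]"
  define B where "B = P [2]"
  define N where "N = P u1"
  have [simp]: "A \<in> carrier_mat 2 2" "N \<in> carrier_mat 2 2"
    "B \<in> carrier_mat 2 2" "P a \<in> carrier_mat 2 2"
    by (simp_all add: A_def B_def N_def)
  note assoc = assoc_mult_mat[of _ 2 2 _ 2 _ 2] mult_carrier_mat[of _ 2 2 _ 2]
  \<comment> \<open>Both words are 1^(m+1) 2 1; with \<open>P u1 = P u2\<close> this is the
    commutation of \<open>N\<close> and \<open>A\<close>.\<close>
  have "u1 @ [1] = [1] @ u2"
    by (simp add: u_defs replicate_append_same flip: replicate_append_same)
  then have "P u1 * A = A * P u2"
    unfolding A_def by (simp flip: P_append)
  then have comm: "N * A = A * N"
    by (simp add: N_def 2)
  \<comment> \<open>Regroup N N as A^(q-2) (B A^(q-2)) B and replace the middle factor by A^(q-2) B.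
    The product then ends in A^(q-3) B^2 = 0.\<close>
  have "N * N = P a * P u3 * B"
  proof -
    have "P u3 = B * P a"
      using P_append[of "[2]" a] by (simp add: B_def u3_def)
    moreover have "N = P a * B"
      by (simp add: N_def B_def u1_def P_append)
    ultimately show ?thesis
      by (simp add: assoc)
  qed
  also have "\<dots> = P a * (P u1 * B)"
    by (simp add: assoc 3[symmetric])
  also have "u1 @ [2] = [1] @ u4"
    by (simp add: u_defs)
  then have "P u1 * B = A * P u4"
    unfolding A_def B_def by (simp flip: P_append)
  finally have NN: "N * N = 0\<^sub>m 2 2"
    by (simp add: 4 right_mult_zero_mat[of _ 2 2])
  have "N * A * (N * A) = N * (A * N) * A"
    by (simp add: assoc)
  also have "\<dots> = N * N * (A * A)"
    by (simp add: assoc flip: comm)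
  finally have "mat_trace (N * A) = 0"
    by (intro mat_trace_eq_0_if_square_eq_0) (simp_all add: NN left_mult_zero_mat[of _ 2 2] mult_carrier_mat[of _ 2 2 _ 2])
  \<comment> \<open>The trace of \<open>N * A\<close> is also the coordinate at
    \<open>u1 @ [1]\<close>, which is 1.\<close>
  then show False
    using tr_u[of u1 0] by (simp add: P_append N_def A_def)
qed

lemma IMPS_not_closed:
  assumes "q > 1" and "odd q"
  shows "\<not> closedin (tensor_topology 4 q) (IMPS 2 4 q :: (nat list \<Rightarrow> 'a::real_normed_field) set)"
proof
  \<comment> \<open>Natural numbers tend to infinity in every real normed field, so the real and
    complex cases need no separate sequences; \<open>Suc\<close> keeps \<open>x n\<close>
    nonzero.\<close>
  define x where "x n = (of_nat (Suc n) :: 'a)" for n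
  define T where "T n =
    restrict (\<lambda>is. inverse (x n ^ q) ^ (weight is - 2) * base_trace is) (multi_indices 4 q)" for n
  assume "closedin (tensor_topology 4 q) (IMPS 2 4 q :: (nat list \<Rightarrow> 'a) set)"
  moreover have "filterlim x at_infinity sequentially"
    unfolding x_def using tendsto_of_nat filterlim_sequentially_Suc by blast
  then have "limitin (tensor_topology 4 q) T (limit_tensor q) sequentially"
    unfolding T_def using assms by (intro limit_tensor_limitin)
  moreover have "T n \<in> IMPS 2 4 q" for n
    unfolding T_def using assms by (intro scaled_tensor_in_IMPS) (simp_all add: x_def del: of_nat_Suc)
  ultimately have "limit_tensor q \<in> (IMPS 2 4 q :: (nat list \<Rightarrow> 'a) set)"
    by (auto intro: limitin_closedin)
  then show False
    using limit_tensor_notin_IMPS assms by blast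
qed

theorem theorem4p6:
  fixes q :: nat
  assumes "q > 1" and "odd q"
  shows "\<not> closedin (tensor_topology 4 q) (IMPS 2 4 q :: (nat list \<Rightarrow> real) set) \<and>
         \<not> closedin (tensor_topology 4 q) (IMPS 2 4 q :: (nat list \<Rightarrow> complex) set)"
  using assms by (simp add: IMPS_not_closed)

end
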